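(* Let $\Phi=\Phi(r,z)$ be a smooth function on $\{r>0,\ z\in\mathbb R\}$, let $m\in\mathbb R$, and let $b_m[\Phi]=(u^r,u^z)$ with $$u^r=-r\Phi_z,\qquad u^z=m\Phi+r\Phi_r .$$ Then $$\operatorname{div}_{3D}b_m:=\partial_ru^r+\frac1r u^r+\partial_zu^z=(m-2)\Phi_z$$ and $$\operatorname{div}_{\mu_5}b_m:=\partial_ru^r+\frac3r u^r+\partial_zu^z=(m-4)\Phi_z .$$ Consequently, $m=2$ gives a field $b_m[\Phi]$ that is incompressible in the three-dimensional axisymmetric sense ($\operatorname{div}_{3D}b_2=0$ for every $\Phi$), while $m=4$ gives a field that is divergence-free with respect to the weighted measure $d\mu_5=r^3\,dr\,dz$ ($\operatorname{div}_{\mu_5}b_4=0$ for every $\Phi$).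
   Context: $(r,z)$ are axisymmetric cylindrical coordinates; subscripts denote partial derivatives. *)

theory Defs
  imports "HOL-Analysis.Analysis"
begin

text \<open>
  A function is of class \<open>C\<^sup>k\<close> on an (open) set if it is continuous there (\<open>k = 0\<close>), respectively
  if it is differentiable there and all its directional derivatives are of class \<open>C\<^sup>k\<^sup>-\<^sup>1\<close>.
  Directions in a finite-dimensional space suffice to describe joint smoothness in all variables.
\<close>

primrec Ck_on :: "nat \<Rightarrow> 'a::euclidean_space set \<Rightarrow> ('a \<Rightarrow> real) \<Rightarrow> bool" where
  "Ck_on 0 S f \<longleftrightarrow> continuous_on S f"
| "Ck_on (Suc k) S f \<longleftrightarrow>
     (\<forall>x\<in>S. f differentiable (at x)) \<and>
     (\<forall>v. Ck_on k S (\<lambda>x. frechet_derivative f (at x) v))"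

definition smooth_on :: "'a::euclidean_space set \<Rightarrow> ('a \<Rightarrow> real) \<Rightarrow> bool" where
  "smooth_on S f \<longleftrightarrow> (\<forall>k. Ck_on k S f)"

text \<open>
  Points of the meridian half-plane are pairs \<open>(r, z)\<close>. Functions are total on \<open>real \<times> real\<close>; only
  their values on the half-plane matter, since that set is open.
\<close>

definition half_plane :: "(real \<times> real) set" where
  "half_plane = {(r, z). r > 0}"

definition partial_r :: "(real \<times> real \<Rightarrow> real) \<Rightarrow> real \<times> real \<Rightarrow> real" where
  "partial_r f = (\<lambda>(r, z). deriv (\<lambda>s. f (s, z)) r)"

definition partial_z :: "(real \<times> real \<Rightarrow> real) \<Rightarrow> real \<times> real \<Rightarrow> real" where
  "partial_z f = (\<lambda>(r, z). deriv (\<lambda>t. f (r, t)) z)"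

text \<open>A meridional vector field has values \<open>(u\<^sup>r, u\<^sup>z)\<close>.\<close>

definition b_field :: "real \<Rightarrow> (real \<times> real \<Rightarrow> real) \<Rightarrow> real \<times> real \<Rightarrow> real \<times> real" where
  "b_field m \<Phi> = (\<lambda>(r, z). (- r * partial_z \<Phi> (r, z), m * \<Phi> (r, z) + r * partial_r \<Phi> (r, z)))"

definition div_3D :: "(real \<times> real \<Rightarrow> real \<times> real) \<Rightarrow> real \<times> real \<Rightarrow> real" where
  "div_3D u = (\<lambda>(r, z). partial_r (\<lambda>p. fst (u p)) (r, z) + 1 / r * fst (u (r, z))
     + partial_z (\<lambda>p. snd (u p)) (r, z))"

text \<open>
  The divergence for the measure \<open>r\<^sup>3 dr dz\<close>, that is
  \<open>r\<^sup>-\<^sup>3 (\<partial>\<^sub>r (r\<^sup>3 u\<^sup>r) + \<partial>\<^sub>z (r\<^sup>3 u\<^sup>z))\<close> with the first term expanded.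
\<close>

definition div_mu5 :: "(real \<times> real \<Rightarrow> real \<times> real) \<Rightarrow> real \<times> real \<Rightarrow> real" where
  "div_mu5 u = (\<lambda>(r, z). partial_r (\<lambda>p. fst (u p)) (r, z) + 3 / r * fst (u (r, z))
     + partial_z (\<lambda>p. snd (u p)) (r, z))"

end

theory Submission
  imports Defs
begin

text \<open>
  Differentiating by the product rule, for any weight exponent \<open>k\<close>,
  \<open>\<partial>\<^sub>r u\<^sup>r + (k / r) u\<^sup>r + \<partial>\<^sub>z u\<^sup>z
    = (- \<Phi>\<^sub>z - r \<Phi>\<^sub>z\<^sub>r) - k \<Phi>\<^sub>z + (m \<Phi>\<^sub>z + r \<Phi>\<^sub>r\<^sub>z)\<close>.
  The second-order terms cancel because mixed partial derivatives commute, which leaves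
  \<open>(m - (k + 1)) \<Phi>\<^sub>z\<close>. The two divergences are the cases \<open>k = 1\<close> and \<open>k = 3\<close>
  (lemma \<open>weighted_div_b_field\<close>).

  The analytic content is therefore the symmetry of the second derivative
  (\<open>second_derivative_commute\<close>). It is obtained from the second difference of \<open>f\<close> over a small
  parallelogram: by the mean value theorem, applied once in each direction, this difference
  equals the area factor times a value of one mixed derivative, and, with the order of the
  directions exchanged, times a value of the other; continuity makes both values converge
  to the values at the corner as the parallelogram shrinks.
\<close>

section \<open>Symmetry of second derivatives\<close>

text \<open>
  The mean value theorem in the first variable is applied to the increment
  \<open>x \<mapsto> f x (b + h) - f x b\<close>, and then in the second variable to the \<open>fx x\<close> that results.
  The second difference on the left is symmetric in the two variables, so exchanging their roles
  expresses the same number through the mixed derivative of the other order.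
\<close>

lemma second_difference_mean_value:
  fixes f fx fxy :: "real \<Rightarrow> real \<Rightarrow> real"
  assumes h: "h > 0"
    and fx: "\<And>x y. \<lbrakk>a \<le> x; x \<le> a + h; b \<le> y; y \<le> b + h\<rbrakk>
              \<Longrightarrow> ((\<lambda>s. f s y) has_real_derivative fx x y) (at x)"
    and fxy: "\<And>x y. \<lbrakk>a \<le> x; x \<le> a + h; b \<le> y; y \<le> b + h\<rbrakk>
              \<Longrightarrow> ((\<lambda>t. fx x t) has_real_derivative fxy x y) (at y)"
  obtains x y where "a < x" "x < a + h" "b < y" "y < b + h"
    "f (a + h) (b + h) - f (a + h) b - f a (b + h) + f a b = h * h * fxy x y"
proof -
  have "\<exists>x. a < x \<and> x < a + h \<and>
      (f (a + h) (b + h) - f (a + h) b) - (f a (b + h) - f a b)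
        = (a + h - a) * (fx x (b + h) - fx x b)"
    using h by (intro MVT2[where f = "\<lambda>s. f s (b + h) - f s b"] DERIV_diff fx) auto
  then obtain x where x: "a < x" "x < a + h"
    "(f (a + h) (b + h) - f (a + h) b) - (f a (b + h) - f a b) = h * (fx x (b + h) - fx x b)"
    by auto
  have "\<exists>y. b < y \<and> y < b + h \<and> fx x (b + h) - fx x b = (b + h - b) * fxy x y"
    using h x by (intro MVT2 fxy) auto
  then obtain y where y: "b < y" "y < b + h" "fx x (b + h) - fx x b = h * fxy x y"
    by auto
  show thesis
    using x y by (intro that[of x y]) (auto simp: algebra_simps)
qed

lemma has_real_derivative_along_line:
  fixes f :: "'a::euclidean_space \<Rightarrow> real"
  assumes "f differentiable (at (p + x *\<^sub>R u))"
  shows "((\<lambda>s. f (p + s *\<^sub>R u)) has_real_derivative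
           frechet_derivative f (at (p + x *\<^sub>R u)) u) (at x)"
proof -
  let ?D = "frechet_derivative f (at (p + x *\<^sub>R u))"
  have D: "(f has_derivative ?D) (at (p + x *\<^sub>R u))"
    using assms frechet_derivative_works by blast
  have "((\<lambda>s. p + s *\<^sub>R u) has_derivative (\<lambda>s. s *\<^sub>R u)) (at x)"
    by (auto intro!: derivative_eq_intros)
  from diff_chain_at[OF this D]
  have "((\<lambda>s. f (p + s *\<^sub>R u)) has_derivative (\<lambda>s. ?D (s *\<^sub>R u))) (at x)"
    by (simp add: o_def)
  moreover have "?D (s *\<^sub>R u) = ?D u * s" for s
    using linear_frechet_derivative[OF assms] by (simp add: linear_cmul)
  ultimately show ?thesis
    by (simp add: has_field_derivative_def)
qed

text \<open>
  Clairaut's theorem (also named after Schwarz), for directional derivatives in arbitrary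
  directions.
\<close>

lemma second_derivative_commute:
  fixes f :: "'a::euclidean_space \<Rightarrow> real"
  assumes S: "open S" and p: "p \<in> S" and f: "Ck_on 2 S f"
  shows "frechet_derivative (\<lambda>q. frechet_derivative f (at q) u) (at p) v
       = frechet_derivative (\<lambda>q. frechet_derivative f (at q) v) (at p) u"
proof -
  define D where "D w = (\<lambda>q. frechet_derivative f (at q) w)" for w
  define DD where "DD w w' = (\<lambda>q. frechet_derivative (D w) (at q) w')" for w w'
  have f1: "f differentiable (at q)" if "q \<in> S" for q
    using f that by (simp add: numeral_2_eq_2)
  have f2: "D w differentiable (at q)" if "q \<in> S" for q w
    using f that by (simp add: numeral_2_eq_2 D_def)
  have cont: "isCont (DD w w') p" for w w'
  proof -
    have "continuous_on S (DD w w')"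
      using f by (simp add: numeral_2_eq_2 D_def DD_def)
    then show ?thesis
      using S p continuous_on_eq_continuous_at by blast
  qed
  have "\<bar>DD u v p - DD v u p\<bar> \<le> e" if e: "e > 0" for e
  proof -
    obtain d1 where d1: "d1 > 0" "ball p d1 \<subseteq> S"
      using S p openE by blast
    obtain d2 where d2: "d2 > 0" "\<And>q. dist q p < d2 \<Longrightarrow> dist (DD u v q) (DD u v p) < e/2"
      using cont[of u v] e unfolding continuous_at_eps_delta by (meson half_gt_zero)
    obtain d3 where d3: "d3 > 0" "\<And>q. dist q p < d3 \<Longrightarrow> dist (DD v u q) (DD v u p) < e/2"
      using cont[of v u] e unfolding continuous_at_eps_delta by (meson half_gt_zero)
    define d where "d = min d1 (min d2 d3)"
    have d: "d > 0" using d1 d2 d3 by (simp add: d_def)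
    \<comment> \<open>The summand 1 keeps the quotient meaningful when both directions vanish, and makes
      the estimate of the distance to \<open>p\<close> strict.\<close>
    define h where "h = d / (norm u + norm v + 1)"
    have pos: "norm u + norm v + 1 > 0"
      by (simp add: add_nonneg_pos)
    have h: "h > 0" using d pos by (simp add: h_def)
    have near: "dist (p + x *\<^sub>R u + y *\<^sub>R v) p < d"
      if "0 \<le> x" "x \<le> h" "0 \<le> y" "y \<le> h" for x y
    proof -
      have "dist (p + x *\<^sub>R u + y *\<^sub>R v) p = norm (x *\<^sub>R u + y *\<^sub>R v)"
        by (simp add: dist_norm)
      also have "\<dots> \<le> x * norm u + y * norm v"
        using norm_triangle_ineq[of "x *\<^sub>R u" "y *\<^sub>R v"] that by simp
      also have "\<dots> \<le> h * norm u + h * norm v"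
        using that by (intro add_mono mult_right_mono) auto
      also have "\<dots> < h * (norm u + norm v + 1)"
        using h by (simp add: algebra_simps)
      also have "\<dots> = d" using pos by (simp add: h_def)
      finally show ?thesis .
    qed
    have inS: "p + x *\<^sub>R u + y *\<^sub>R v \<in> S"
      if "0 \<le> x" "x \<le> h" "0 \<le> y" "y \<le> h" for x y
      using near[OF that] d1 by (auto simp: d_def dist_commute)
    have line_u: "((\<lambda>s. g (p + s *\<^sub>R u + y *\<^sub>R v)) has_real_derivative
        frechet_derivative g (at (p + x *\<^sub>R u + y *\<^sub>R v)) u) (at x)"
      if "g differentiable (at (p + x *\<^sub>R u + y *\<^sub>R v))" for g :: "'a \<Rightarrow> real" and x y
      using has_real_derivative_along_line[of g "p + y *\<^sub>R v" x u] that
      by (simp add: add_ac)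
    have line_v: "((\<lambda>t. g (p + x *\<^sub>R u + t *\<^sub>R v)) has_real_derivative
        frechet_derivative g (at (p + x *\<^sub>R u + y *\<^sub>R v)) v) (at y)"
      if "g differentiable (at (p + x *\<^sub>R u + y *\<^sub>R v))" for g :: "'a \<Rightarrow> real" and x y
      using has_real_derivative_along_line[of g "p + x *\<^sub>R u" y v] that by simp
    define \<Delta> where "\<Delta> = f (p + h *\<^sub>R u + h *\<^sub>R v) - f (p + h *\<^sub>R u) - f (p + h *\<^sub>R v) + f p"
    obtain x1 y1 where 1: "0 < x1" "x1 < h" "0 < y1" "y1 < h"
      "\<Delta> = h * h * DD u v (p + x1 *\<^sub>R u + y1 *\<^sub>R v)"
    proof (rule second_difference_mean_value[of h 0 0
          "\<lambda>x y. f (p + x *\<^sub>R u + y *\<^sub>R v)" "\<lambda>x y. D u (p + x *\<^sub>R u + y *\<^sub>R v)"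
          "\<lambda>x y. DD u v (p + x *\<^sub>R u + y *\<^sub>R v)"])
      show "((\<lambda>s. f (p + s *\<^sub>R u + y *\<^sub>R v)) has_real_derivative
          D u (p + x *\<^sub>R u + y *\<^sub>R v)) (at x)"
        if "0 \<le> x" "x \<le> 0 + h" "0 \<le> y" "y \<le> 0 + h" for x y
        using line_u[of f x y] f1 inS that by (simp add: D_def)
      show "((\<lambda>t. D u (p + x *\<^sub>R u + t *\<^sub>R v)) has_real_derivative
          DD u v (p + x *\<^sub>R u + y *\<^sub>R v)) (at y)"
        if "0 \<le> x" "x \<le> 0 + h" "0 \<le> y" "y \<le> 0 + h" for x y
        using line_v[of "D u" x y] f2 inS that by (simp add: DD_def)
    qed (use h in \<open>auto simp: \<Delta>_def\<close>)
    obtain y2 x2 where 2: "0 < x2" "x2 < h" "0 < y2" "y2 < h"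
      "\<Delta> = h * h * DD v u (p + x2 *\<^sub>R u + y2 *\<^sub>R v)"
    proof (rule second_difference_mean_value[of h 0 0
          "\<lambda>y x. f (p + x *\<^sub>R u + y *\<^sub>R v)" "\<lambda>y x. D v (p + x *\<^sub>R u + y *\<^sub>R v)"
          "\<lambda>y x. DD v u (p + x *\<^sub>R u + y *\<^sub>R v)"])
      show "((\<lambda>t. f (p + x *\<^sub>R u + t *\<^sub>R v)) has_real_derivative
          D v (p + x *\<^sub>R u + y *\<^sub>R v)) (at y)"
        if "0 \<le> y" "y \<le> 0 + h" "0 \<le> x" "x \<le> 0 + h" for x y
        using line_v[of f x y] f1 inS that by (simp add: D_def)
      show "((\<lambda>s. D v (p + s *\<^sub>R u + y *\<^sub>R v)) has_real_derivative
          DD v u (p + x *\<^sub>R u + y *\<^sub>R v)) (at x)"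
        if "0 \<le> y" "y \<le> 0 + h" "0 \<le> x" "x \<le> 0 + h" for x y
        using line_u[of "D v" x y] f2 inS that by (simp add: DD_def)
    qed (use h in \<open>auto simp: \<Delta>_def algebra_simps\<close>)
    have "DD u v (p + x1 *\<^sub>R u + y1 *\<^sub>R v) = DD v u (p + x2 *\<^sub>R u + y2 *\<^sub>R v)"
      using 1(5) 2(5) h by simp
    moreover have "dist (DD u v (p + x1 *\<^sub>R u + y1 *\<^sub>R v)) (DD u v p) < e/2"
      using d2(2) near[of x1 y1] 1 by (simp add: d_def)
    moreover have "dist (DD v u (p + x2 *\<^sub>R u + y2 *\<^sub>R v)) (DD v u p) < e/2"
      using d3(2) near[of x2 y2] 2 by (simp add: d_def)
    ultimately have "dist (DD u v p) (DD v u p) < e"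
      using dist_triangle_half_r by metis
    then show ?thesis
      by (simp add: dist_real_def)
  qed
  then have "\<bar>DD u v p - DD v u p\<bar> \<le> 0"
    by - (rule field_le_epsilon, simp)
  then have "DD u v p = DD v u p"
    by linarith
  then show ?thesis
    unfolding DD_def D_def .
qed

section \<open>Partial derivatives on the half-plane\<close>

lemma open_half_plane: "open half_plane"
proof -
  have "half_plane = {0<..} \<times> UNIV" by (auto simp: half_plane_def)
  also have "open \<dots>" by (intro open_Times) auto
  finally show ?thesis .
qed

lemma has_real_derivative_r:
  fixes f :: "real \<times> real \<Rightarrow> real"
  assumes "f differentiable (at (r, z))"
  shows "((\<lambda>s. f (s, z)) has_real_derivative frechet_derivative f (at (r, z)) (1, 0)) (at r)"
  using has_real_derivative_along_line[of f "(0, z)" r "(1, 0)"] assms by simp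

lemma has_real_derivative_z:
  fixes f :: "real \<times> real \<Rightarrow> real"
  assumes "f differentiable (at (r, z))"
  shows "((\<lambda>t. f (r, t)) has_real_derivative frechet_derivative f (at (r, z)) (0, 1)) (at z)"
  using has_real_derivative_along_line[of f "(r, 0)" z "(0, 1)"] assms by simp

lemma partial_r_eq_frechet_derivative:
  "f differentiable (at p) \<Longrightarrow> partial_r f p = frechet_derivative f (at p) (1, 0)"
  by (cases p) (simp add: partial_r_def DERIV_imp_deriv[OF has_real_derivative_r])

lemma partial_z_eq_frechet_derivative:
  "f differentiable (at p) \<Longrightarrow> partial_z f p = frechet_derivative f (at p) (0, 1)"
  by (cases p) (simp add: partial_z_def DERIV_imp_deriv[OF has_real_derivative_z])

section \<open>The weighted divergence of the field\<close>

text \<open>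
  The expression on the left is the divergence for the measure \<open>r\<^sup>k dr dz\<close>. Treating \<open>k\<close> as a
  parameter shows that \<open>m = k + 1\<close> is what makes the field divergence-free.
\<close>

lemma weighted_div_b_field:
  assumes \<Phi>: "Ck_on 2 half_plane \<Phi>" and rz: "(r, z) \<in> half_plane"
  shows "partial_r (\<lambda>p. fst (b_field m \<Phi> p)) (r, z) + k / r * fst (b_field m \<Phi> (r, z))
       + partial_z (\<lambda>p. snd (b_field m \<Phi> p)) (r, z) = (m - (k + 1)) * partial_z \<Phi> (r, z)"
proof -
  define R where "R = (\<lambda>q. frechet_derivative \<Phi> (at q) (1, 0))"
  define Z where "Z = (\<lambda>q. frechet_derivative \<Phi> (at q) (0, 1))"
  define Rz where "Rz = frechet_derivative R (at (r, z)) (0, 1)"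
  define Zr where "Zr = frechet_derivative Z (at (r, z)) (1, 0)"
  have r: "r > 0" using rz by (simp add: half_plane_def)
  have diff: "\<Phi> differentiable (at q)" if "q \<in> half_plane" for q
    using \<Phi> that by (simp add: numeral_2_eq_2)
  have R: "R differentiable (at (r, z))" and Z: "Z differentiable (at (r, z))"
    using \<Phi> rz by (simp_all add: numeral_2_eq_2 R_def Z_def)
  have symm: "Rz = Zr"
    using second_derivative_commute[OF open_half_plane rz \<Phi>]
    by (simp add: Rz_def Zr_def R_def Z_def)
  have partial_r: "partial_r \<Phi> q = R q" if "q \<in> half_plane" for q
    using partial_r_eq_frechet_derivative diff[OF that] by (simp add: R_def)
  have partial_z: "partial_z \<Phi> q = Z q" if "q \<in> half_plane" for q
    using partial_z_eq_frechet_derivative diff[OF that] by (simp add: Z_def)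
  have "((\<lambda>s. - s * Z (s, z)) has_real_derivative - Z (r, z) - r * Zr) (at r)"
    using DERIV_mult[OF DERIV_minus[OF DERIV_ident] has_real_derivative_r[OF Z]]
    by (simp add: Zr_def algebra_simps)
  \<comment> \<open>The partial derivatives of \<open>\<Phi>\<close> are under control only for positive radius, hence the
    passage through a neighbourhood of \<open>r\<close>.\<close>
  then have "((\<lambda>s. fst (b_field m \<Phi> (s, z))) has_real_derivative - Z (r, z) - r * Zr) (at r)"
    by (rule has_field_derivative_transform_within_open[where S = "{0<..}"])
      (use r in \<open>auto simp: b_field_def partial_z half_plane_def\<close>)
  then have ur: "partial_r (\<lambda>p. fst (b_field m \<Phi> p)) (r, z) = - Z (r, z) - r * Zr"
    by (simp add: partial_r_def DERIV_imp_deriv)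
  have "((\<lambda>t. m * \<Phi> (r, t) + r * R (r, t)) has_real_derivative m * Z (r, z) + r * Rz) (at z)"
    unfolding Rz_def Z_def
    by (intro DERIV_add DERIV_cmult has_real_derivative_z R diff rz)
  moreover have "snd (b_field m \<Phi> (r, t)) = m * \<Phi> (r, t) + r * R (r, t)" for t
    using r by (simp add: b_field_def partial_r half_plane_def)
  ultimately have uz: "partial_z (\<lambda>p. snd (b_field m \<Phi> p)) (r, z) = m * Z (r, z) + r * Rz"
    by (simp add: partial_z_def DERIV_imp_deriv)
  have "fst (b_field m \<Phi> (r, z)) = - r * Z (r, z)"
    by (simp add: b_field_def partial_z rz)
  with r show ?thesis
    by (simp add: ur uz symm partial_z rz) (simp add: algebra_simps)
qed

theorem proposition5p1:
  shows "(\<forall>(m::real) \<Phi>. smooth_on half_plane \<Phi> \<longrightarrow>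
           (\<forall>p\<in>half_plane.
              div_3D (b_field m \<Phi>) p = (m - 2) * partial_z \<Phi> p \<and>
              div_mu5 (b_field m \<Phi>) p = (m - 4) * partial_z \<Phi> p)) \<and>
         (\<forall>\<Phi>. smooth_on half_plane \<Phi> \<longrightarrow> (\<forall>p\<in>half_plane. div_3D (b_field 2 \<Phi>) p = 0)) \<and>
         (\<forall>\<Phi>. smooth_on half_plane \<Phi> \<longrightarrow> (\<forall>p\<in>half_plane. div_mu5 (b_field 4 \<Phi>) p = 0))"
proof -
  have *: "div_3D (b_field m \<Phi>) p = (m - 2) * partial_z \<Phi> p \<and>
           div_mu5 (b_field m \<Phi>) p = (m - 4) * partial_z \<Phi> p"
    if "smooth_on half_plane \<Phi>" "p \<in> half_plane" for m \<Phi> p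
  proof (cases p)
    case (Pair r z)
    have "Ck_on 2 half_plane \<Phi>"
      using that unfolding smooth_on_def by blast
    from weighted_div_b_field[OF this, of r z m 1] weighted_div_b_field[OF this, of r z m 3]
    show ?thesis
      using that by (simp add: Pair div_3D_def div_mu5_def)
  qed
  then show ?thesis by simp
qed

end
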